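(* There exists an absolute constant $C$ such that the following holds. Let $m>1$ be an integer having $d$ prime factors counted with multiplicity. If a polynomial $f\in \mathbb{Z}_m[x_1,\ldots,x_n]$ of degree at most $2$ weakly represents $\mathrm{OR}_n$ modulo $m$, then \[ n\le m^{Cd}\le m^{C\log_2 m}. \]
   Context: Let $B=\{0,1\}\subseteq\mathbb{Z}$ and $\mathbb{Z}_m$ the ring of integers modulo $m$. The function $\mathrm{OR}_n:B^n\to B$ is defined by $\mathrm{OR}_n(\mathbf 0)=0$ and $\mathrm{OR}_n(\mathbf x)=1$ for $\mathbf x\neq \mathbf 0$. A function $f:B^n\to\mathbb{Z}_m$ (here a polynomial over $\mathbb{Z}_m$ evaluated at points of $B^n$) weakly represents a function $g:B^n\to B$ if there is a partition $\mathbb{Z}_m=A\cup A^c$ such that for all $\mathbf x\in B^n$: $g(\mathbf x)=0 \iff f(\mathbf x)\in A$ and $g(\mathbf x)=1\iff f(\mathbf x)\in A^c$. *)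

theory Defs
  imports
    Complex_Main
    "HOL-Number_Theory.Residues"
    "HOL-Algebra.Indexed_Polynomials"
begin

text \<open>
  Multivariate polynomials are the indexed polynomials of \<open>HOL-Algebra\<close>: functions from
  monomials (multisets of variable indices) to coefficients, generated by the constants under
  addition and multiplication by a variable. The library provides neither their total degree nor
  their evaluation at a point of the base ring; both are defined here by means of the support.
\<close>

definition mpoly_support :: "('a, 'b) ring_scheme \<Rightarrow> ('c multiset \<Rightarrow> 'a) \<Rightarrow> 'c multiset set" where
  "mpoly_support R P = {M. P M \<noteq> \<zero>\<^bsub>R\<^esub>}"

lemma (in ring) finite_mpoly_support:
  assumes "P \<in> indexed_pset I (carrier R)"
  shows "finite (mpoly_support R P)"
  using assms
proof induction
  case (indexed_const k)
  have "mpoly_support R (indexed_const k) \<subseteq> {{#}}"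
    by (auto simp: mpoly_support_def indexed_const_def)
  then show ?case
    by (rule finite_subset) simp
next
  case (indexed_padd P Q)
  have "mpoly_support R (indexed_padd P Q) \<subseteq> mpoly_support R P \<union> mpoly_support R Q"
    by (auto simp: mpoly_support_def indexed_padd_def)
  then show ?case
    using indexed_padd.IH by (rule finite_subset[OF _ finite_UnI])
next
  case (indexed_pmult P i)
  have "mpoly_support R (indexed_pmult P i) \<subseteq> add_mset i ` mpoly_support R P"
    by (force simp: mpoly_support_def indexed_pmult_def split: if_splits)
  then show ?case
    using indexed_pmult.IH by (rule finite_subset[OF _ finite_imageI])
qed

text \<open>The zero polynomial is given degree \<open>0\<close>, so that it counts as a polynomial of
  degree at most \<open>k\<close> for every \<open>k\<close>.\<close>

definition mpoly_degree :: "('a, 'b) ring_scheme \<Rightarrow> ('c multiset \<Rightarrow> 'a) \<Rightarrow> nat" where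
  "mpoly_degree R P = Max (insert 0 (size ` mpoly_support R P))"

definition mpoly_eval ::
  "('a, 'b) ring_scheme \<Rightarrow> ('c multiset \<Rightarrow> 'a) \<Rightarrow> ('c \<Rightarrow> 'a) \<Rightarrow> 'a" where
  "mpoly_eval R P x =
     (\<Oplus>\<^bsub>R\<^esub>M \<in> mpoly_support R P.
        P M \<otimes>\<^bsub>R\<^esub> (\<Otimes>\<^bsub>R\<^esub>i \<in> set_mset M. x i [^]\<^bsub>R\<^esub> count M i))"

definition mpoly_over_Zm :: "nat \<Rightarrow> nat \<Rightarrow> (nat multiset \<Rightarrow> int) set" where
  "mpoly_over_Zm m n =
     ring.indexed_pset (residue_ring (int m)) {1..n} (carrier (residue_ring (int m)))"

text \<open>The coordinates \<open>0\<close> and \<open>1\<close> are integers. For \<open>m > 1\<close> they lie in the carrier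
  \<open>{0..m - 1}\<close> of \<open>residue_ring m\<close>, so no reduction is needed before evaluating a
  polynomial over that ring.\<close>

definition cube :: "nat \<Rightarrow> (nat \<Rightarrow> int) set" where
  "cube n = {1..n} \<rightarrow>\<^sub>E {0, 1}"

definition OR :: "nat \<Rightarrow> (nat \<Rightarrow> int) \<Rightarrow> int" where
  "OR n x = (if \<forall>i \<in> {1..n}. x i = 0 then 0 else 1)"

definition weakly_represents ::
  "nat \<Rightarrow> nat \<Rightarrow> ((nat \<Rightarrow> int) \<Rightarrow> int) \<Rightarrow> ((nat \<Rightarrow> int) \<Rightarrow> int) \<Rightarrow> bool" where
  "weakly_represents m n f g \<longleftrightarrow>
     (\<exists>A \<subseteq> carrier (residue_ring (int m)). \<forall>x \<in> cube n.
        (g x = 0 \<longleftrightarrow> f x \<in> A) \<and>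
        (g x = 1 \<longleftrightarrow> f x \<in> carrier (residue_ring (int m)) - A))"

end

theory Submission
  imports Defs
begin

text \<open>
  Let \<open>d\<close> be the number of prime factors of \<open>m\<close>. Any \<open>r ^ d * m\<close> vectors in \<open>\<int>\<^sub>m\<^sup>r\<close> have a
  nonempty subfamily with sum zero: for a prime \<open>p\<close> this is Olson's argument that a polynomial of
  degree \<open>r * (p - 1)\<close> cannot be the indicator of the origin of a cube of larger dimension, and
  the general case follows by splitting off one prime at a time. Hence, if \<open>n \<ge> m ^ (d + 2)\<close>,
  one can greedily choose disjoint nonempty blocks \<open>S\<^sub>1, \<dots>, S\<^sub>m\<close> of variables such that
  all cross terms of \<open>f\<close> between two different blocks vanish modulo \<open>m\<close>, as this imposes
  fewer than \<open>m\<close> linear conditions on each new block. On unions of blocks \<open>f - f(0)\<close> is then additive,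
  so some nonempty union of blocks is a point where \<open>f\<close> takes the value \<open>f(0)\<close>.
\<close>

section \<open>Alternating sums of low-degree set functions\<close>

text \<open>Set functions which, read on indicator vectors, are polynomials of degree at most \<open>D\<close>.\<close>

inductive low_degree :: "nat \<Rightarrow> ('a set \<Rightarrow> int) \<Rightarrow> bool" where
  const: "low_degree D (\<lambda>_. c)"
| add: "low_degree D g \<Longrightarrow> low_degree D h \<Longrightarrow> low_degree D (\<lambda>S. g S + h S)"
| mult: "low_degree D h \<Longrightarrow> low_degree (Suc D) (\<lambda>S. sum a S * h S)"

lemma low_degree_mono: "low_degree D h \<Longrightarrow> D \<le> E \<Longrightarrow> low_degree E h"
proof (induction arbitrary: E rule: low_degree.induct)
  case (mult D h a)
  then obtain E' where "E = Suc E'" "D \<le> E'" by (cases E) auto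
  with mult show ?case by (auto intro: low_degree.mult)
qed (auto intro: low_degree.intros)

lemma low_degree_mult_const: "low_degree D h \<Longrightarrow> low_degree D (\<lambda>S. c * h S)"
proof (induction rule: low_degree.induct)
  case (add D g h)
  then show ?case
    using low_degree.add[of D "\<lambda>S. c * g S" "\<lambda>S. c * h S"] by (simp add: distrib_left)
next
  case (mult D h a)
  from low_degree.mult[OF mult.IH, of a] show ?case
    by (simp add: mult.left_commute)
qed (auto intro: low_degree.intros)

lemma low_degree_mult_power: "low_degree D h \<Longrightarrow> low_degree (D + k) (\<lambda>S. sum a S ^ k * h S)"
proof (induction k)
  case (Suc k)
  from low_degree.mult[OF Suc.IH[OF Suc.prems], of a] show ?case
    by (simp add: mult.assoc)
qed simp

text \<open>For \<open>k = p - 1\<close> with \<open>p\<close> prime, Fermat's theorem makes this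
  product the indicator modulo \<open>p\<close> of the event that all \<open>r\<close> sums are
  divisible by \<open>p\<close>. Every further factor costs degree \<open>k\<close>.\<close>

lemma low_degree_prod_one_minus_power:
  "low_degree (r * k) (\<lambda>S. \<Prod>j<r. 1 - sum (a j) S ^ k)"
proof (induction r)
  case 0
  show ?case by (simp add: low_degree.const)
next
  case (Suc r)
  let ?h = "\<lambda>S. \<Prod>j<r. 1 - sum (a j) S ^ k"
  have "low_degree (r * k + k) (\<lambda>S. ?h S + (- 1) * (sum (a r) S ^ k * ?h S))"
    by (intro low_degree.add low_degree_mult_const low_degree_mult_power Suc.IH
          low_degree_mono[OF Suc.IH]) simp
  then show ?case
    by (simp add: algebra_simps)
qed

text \<open>Removing \<open>i\<close> is a bijection onto \<open>Pow (V - {i})\<close> that flips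
  the sign. It moves \<open>i\<close> from the range of summation into the fixed part of the
  argument of \<open>g\<close>.\<close>

lemma sum_Pow_containing:
  fixes g :: "'a set \<Rightarrow> int"
  assumes "finite V" "i \<in> V"
  shows "(\<Sum>S | S \<in> Pow V \<and> i \<in> S. (- 1) ^ card S * g S) =
    - (\<Sum>S\<in>Pow (V - {i}). (- 1) ^ card S * g (insert i S))"
proof -
  have "{S. S \<in> Pow V \<and> i \<in> S} = insert i ` Pow (V - {i})"
  proof (intro equalityI subsetI)
    fix S assume "S \<in> {S. S \<in> Pow V \<and> i \<in> S}"
    then have "S = insert i (S - {i})" "S - {i} \<in> Pow (V - {i})" by auto
    then show "S \<in> insert i ` Pow (V - {i})" by blast
  qed (use assms in auto)
  moreover have "inj_on (insert i) (Pow (V - {i}))"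
    by (rule inj_onI) blast
  ultimately have "(\<Sum>S | S \<in> Pow V \<and> i \<in> S. (- 1) ^ card S * g S) =
      (\<Sum>S\<in>Pow (V - {i}). (- 1) ^ card (insert i S) * g (insert i S))"
    by (simp only: sum.reindex o_def)
  also have "\<dots> = (\<Sum>S\<in>Pow (V - {i}). - ((- 1) ^ card S * g (insert i S)))"
  proof (rule sum.cong)
    fix S assume S: "S \<in> Pow (V - {i})"
    then have "finite S" using assms finite_subset by blast
    moreover have "i \<notin> S" using S by auto
    ultimately show "(- 1) ^ card (insert i S) * g (insert i S) = - ((- 1) ^ card S * g (insert i S))"
      by simp
  qed simp
  finally show ?thesis by (simp add: sum_negf)
qed

text \<open>Up to sign this is an iterated finite difference of \<open>h\<close> in more directions
  than its degree. In a product with \<open>sum a S\<close>, the summand \<open>a i\<close> forces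
  \<open>i\<close> into \<open>S\<close>, which lowers both the degree and the dimension of the cube
  by one; the forced elements accumulate in \<open>T\<close>.\<close>

lemma low_degree_alternating_sum:
  assumes "low_degree D h" "finite V" "finite T" "V \<inter> T = {}" "D < card V"
  shows "(\<Sum>S\<in>Pow V. (- 1) ^ card S * h (S \<union> T)) = 0"
  using assms
proof (induction arbitrary: V T rule: low_degree.induct)
  case (const D c)
  have "(\<Sum>S\<in>Pow V. (- 1) ^ card S * c) = (\<Prod>i\<in>V. 1 - 1) * c"
    unfolding sum_distrib_right[symmetric] by (subst prod_diff_conv_sum) (simp_all add: const)
  also have "(\<Prod>i\<in>V. 1 - 1 :: int) = 0"
    using const by (auto simp: card_gt_0_iff)
  finally show ?case by simp
next
  case (add D g h)
  from add.IH(1)[OF add.prems] add.IH(2)[OF add.prems] show ?case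
    by (simp add: distrib_left sum.distrib)
next
  case (mult D h a)
  let ?w = "\<lambda>S. (- 1) ^ card S * h (S \<union> T)"
  have split: "sum a (S \<union> T) = (\<Sum>i\<in>V. if i \<in> S then a i else 0) + sum a T" if "S \<in> Pow V" for S
  proof -
    have "sum a (S \<union> T) = sum a S + sum a T"
      using that mult.prems by (intro sum.union_disjoint) (auto intro: finite_subset)
    moreover have "V \<inter> S = S" using that by auto
    ultimately show ?thesis
      using mult.prems(1) by (simp add: sum.inter_restrict[symmetric])
  qed
  \<comment> \<open>Forcing \<open>i\<close> into \<open>S\<close> leaves a cube on
    \<open>V - {i}\<close> with \<open>i\<close> added to \<open>T\<close>. Its dimension still
    exceeds \<open>D\<close>, because that of \<open>V\<close> exceeds \<open>Suc D\<close>.\<close>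
  have zero: "(\<Sum>S | S \<in> Pow V \<and> i \<in> S. ?w S) = 0" if i: "i \<in> V" for i
  proof -
    have "(\<Sum>S\<in>Pow (V - {i}). (- 1) ^ card S * h (S \<union> insert i T)) = 0"
      using i mult.prems by (intro mult.IH) auto
    then show ?thesis
      using sum_Pow_containing[OF mult.prems(1) i, of "\<lambda>S. h (S \<union> T)"] by simp
  qed
  have "(\<Sum>S\<in>Pow V. (- 1) ^ card S * (sum a (S \<union> T) * h (S \<union> T))) =
      (\<Sum>S\<in>Pow V. (\<Sum>i\<in>V. if i \<in> S then a i * ?w S else 0) + sum a T * ?w S)"
  proof (rule sum.cong)
    fix S assume "S \<in> Pow V"
    then have "(- 1) ^ card S * (sum a (S \<union> T) * h (S \<union> T)) =
        (\<Sum>i\<in>V. if i \<in> S then a i else 0) * ?w S + sum a T * ?w S"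
      by (simp only: split) (simp add: algebra_simps)
    also have "(\<Sum>i\<in>V. if i \<in> S then a i else 0) * ?w S = (\<Sum>i\<in>V. if i \<in> S then a i * ?w S else 0)"
      unfolding sum_distrib_right by (rule sum.cong) auto
    finally show "(- 1) ^ card S * (sum a (S \<union> T) * h (S \<union> T)) =
        (\<Sum>i\<in>V. if i \<in> S then a i * ?w S else 0) + sum a T * ?w S" .
  qed simp
  also have "\<dots> = (\<Sum>i\<in>V. \<Sum>S\<in>Pow V. if i \<in> S then a i * ?w S else 0) + sum a T * (\<Sum>S\<in>Pow V. ?w S)"
    unfolding sum.distrib sum_distrib_left[symmetric] by (subst sum.swap) simp
  also have "(\<Sum>S\<in>Pow V. ?w S) = 0"
    using mult.prems by (intro mult.IH) auto
  also have "(\<Sum>i\<in>V. \<Sum>S\<in>Pow V. if i \<in> S then a i * ?w S else 0) = (\<Sum>i\<in>V. 0)"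
  proof (rule sum.cong)
    fix i assume i: "i \<in> V"
    have "(\<Sum>S\<in>Pow V. if i \<in> S then a i * ?w S else 0) = (\<Sum>S | S \<in> Pow V \<and> i \<in> S. a i * ?w S)"
      using mult.prems(1) by (intro sum.inter_filter[symmetric]) simp
    also have "\<dots> = a i * (\<Sum>S | S \<in> Pow V \<and> i \<in> S. ?w S)"
      by (simp only: sum_distrib_left)
    finally show "(\<Sum>S\<in>Pow V. if i \<in> S then a i * ?w S else 0) = 0"
      using zero[OF i] by simp
  qed simp
  finally show ?case by simp
qed

section \<open>Zero-sum subfamilies modulo a prime\<close>

lemma fermat_theorem_int:
  assumes "Factorial_Ring.prime p" "\<not> int p dvd x"
  shows "[x ^ (p - 1) = 1] (mod int p)"
proof -
  define y where "y = nat (x mod int p)"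
  have y: "int y = x mod int p"
    using prime_gt_0_nat[OF assms(1)] by (simp add: y_def)
  then have cong: "[int y = x] (mod int p)" by (simp add: cong_def)
  then have "\<not> p dvd y"
    using assms(2) cong_dvd_iff int_dvd_int_iff by blast
  then have "[int (y ^ (p - 1)) = int 1] (mod int p)"
    unfolding cong_int_iff by (rule fermat_theorem[OF assms(1)])
  then show ?thesis
    using cong_pow[OF cong, of "p - 1"] by (simp add: cong_def)
qed

text \<open>Otherwise \<open>?G\<close> would vanish modulo \<open>p\<close> at every nonempty
  subset and equal 1 at the empty one, so its alternating sum would be 1 modulo \<open>p\<close>.
  But that sum is 0, since the degree \<open>r * (p - 1)\<close> is below the dimension
  \<open>card V\<close>.\<close>

lemma zero_sum_subset_prime:
  fixes a :: "nat \<Rightarrow> 'a \<Rightarrow> int"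
  assumes "Factorial_Ring.prime p" "finite V" "r * (p - 1) < card V"
  obtains S where "S \<subseteq> V" "S \<noteq> {}" "\<And>j. j < r \<Longrightarrow> int p dvd sum (a j) S"
proof (rule ccontr)
  assume "\<not> thesis"
  with that have no: "\<exists>j<r. \<not> int p dvd sum (a j) S" if "S \<subseteq> V" "S \<noteq> {}" for S
    using that by blast
  let ?G = "\<lambda>S. \<Prod>j<r. 1 - sum (a j) S ^ (p - 1)"
  have dvd: "int p dvd (\<Sum>S\<in>Pow V - {{}}. (- 1) ^ card S * ?G S)"
  proof (rule dvd_sum)
    fix S assume "S \<in> Pow V - {{}}"
    then obtain j where j: "j < r" "\<not> int p dvd sum (a j) S" using no by blast
    have "int p dvd 1 - sum (a j) S ^ (p - 1)"
      using fermat_theorem_int[OF assms(1) j(2)]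
      by (simp add: cong_iff_dvd_diff dvd_diff_commute)
    also have "\<dots> dvd ?G S" using j(1) by (intro dvd_prodI) auto
    finally show "int p dvd (- 1) ^ card S * ?G S" by (rule dvd_mult)
  qed
  have "(\<Sum>S\<in>Pow V. (- 1) ^ card S * ?G (S \<union> {})) = 0"
    by (rule low_degree_alternating_sum[OF low_degree_prod_one_minus_power]) (use assms in auto)
  moreover have "(\<Sum>S\<in>Pow V. (- 1) ^ card S * ?G (S \<union> {})) =
      ?G {} + (\<Sum>S\<in>Pow V - {{}}. (- 1) ^ card S * ?G S)"
    using assms(2) by (subst sum.remove[of _ "{}"]) auto
  \<comment> \<open>Here \<open>p - 1 > 0\<close> matters: \<open>0 ^ 0 = 1\<close> would make the
    factors vanish.\<close>
  moreover have "?G {} = 1"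
    using prime_gt_1_nat[OF assms(1)] by (simp add: power_0_left)
  ultimately have "(\<Sum>S\<in>Pow V - {{}}. (- 1) ^ card S * ?G S) = - 1"
    by linarith
  with dvd have "int p dvd - 1" by simp
  then show False using prime_gt_1_nat[OF assms(1)] by simp
qed

section \<open>Zero-sum subfamilies modulo an arbitrary integer\<close>

text \<open>Greedy choice: each round keeps a good set inside some \<open>q\<close> of the remaining
  elements and discards all \<open>q\<close> of them, so \<open>k\<close> rounds consume
  \<open>q * k\<close> elements.\<close>

lemma disjoint_family_of_good_subsets:
  assumes "\<And>W. W \<subseteq> V \<Longrightarrow> card W = q \<Longrightarrow> \<exists>S\<subseteq>W. S \<noteq> {} \<and> good S"
    and "finite V" "q * k \<le> card V"
  obtains S :: "nat \<Rightarrow> 'a set" where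
    "\<And>i. i < k \<Longrightarrow> S i \<subseteq> V \<and> S i \<noteq> {} \<and> good (S i)" "disjoint_family_on S {..<k}"
proof -
  have "\<exists>S :: nat \<Rightarrow> 'a set. (\<forall>i<k. S i \<subseteq> V \<and> S i \<noteq> {} \<and> good (S i)) \<and> disjoint_family_on S {..<k}"
    using assms
  proof (induction k arbitrary: V)
    case 0
    show ?case by (simp add: disjoint_family_on_def)
  next
    case (Suc k)
    have "q \<le> card V" using Suc.prems(3) by simp
    then obtain W where W: "W \<subseteq> V" "card W = q" by (meson obtain_subset_with_card_n)
    obtain T where T: "T \<subseteq> W" "T \<noteq> {}" "good T" using Suc.prems(1)[OF W] by blast
    have "q * k \<le> card (V - W)"
      using W Suc.prems(2,3) by (simp add: card_Diff_subset finite_subset)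
    then have "\<exists>S :: nat \<Rightarrow> 'a set. (\<forall>i<k. S i \<subseteq> V - W \<and> S i \<noteq> {} \<and> good (S i)) \<and> disjoint_family_on S {..<k}"
      using Suc.prems(2) by (intro Suc.IH Suc.prems(1)) auto
    then obtain S where S: "\<And>i. i < k \<Longrightarrow> S i \<subseteq> V - W \<and> S i \<noteq> {} \<and> good (S i)"
      "disjoint_family_on S {..<k}" by blast
    have "disjoint_family_on (S(k := T)) {..<Suc k}"
      using S T(1) unfolding disjoint_family_on_def by (fastforce simp: less_Suc_eq)
    moreover have "\<forall>i<Suc k. (S(k := T)) i \<subseteq> V \<and> (S(k := T)) i \<noteq> {} \<and> good ((S(k := T)) i)"
      using S(1) T W(1) by (auto simp: less_Suc_eq)
    ultimately show ?case by blast
  qed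
  then show ?thesis using that by blast
qed

text \<open>To pass from \<open>m\<close> to \<open>p * m\<close>, cut \<open>V\<close> into groups
  of \<open>r * p\<close> elements; each contains a subset whose \<open>r\<close> sums are divisible
  by \<open>p\<close>. These subsets serve as the elements for \<open>m\<close>, with their sums
  divided by \<open>p\<close> as the new vectors. Thus every prime \<open>p\<close> costs a factor
  \<open>r * p\<close>.\<close>

lemma zero_sum_subset:
  fixes a :: "nat \<Rightarrow> nat \<Rightarrow> int"
  assumes "m > 0" "r > 0" "finite V" "r ^ size (prime_factorization m) * m \<le> card V"
  shows "\<exists>S\<subseteq>V. S \<noteq> {} \<and> (\<forall>j<r. int m dvd sum (a j) S)"
  using assms
proof (induction m arbitrary: V a rule: prime_divisors_induct)
  case zero
  then show ?case by simp
next
  case (unit u)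
  \<comment> \<open>The bound reads \<open>1 \<le> card V\<close> here, so \<open>V\<close> itself
    is a nonempty witness.\<close>
  then show ?case by (intro exI[of _ V]) auto
next
  case (factor p m)
  have m: "m > 0" and p: "Factorial_Ring.prime p" using factor by auto
  let ?K = "r ^ size (prime_factorization m) * m"
  have "prime_factorization (p * m) = add_mset p (prime_factorization m)"
    using m p by (simp add: prime_factorization_mult prime_factorization_prime prime_gt_0_nat)
  then have "(r * p) * ?K \<le> card V"
    using factor.prems(4) by (simp add: mult.assoc mult.left_commute)
  moreover have "\<exists>S\<subseteq>W. S \<noteq> {} \<and> (\<forall>j<r. int p dvd sum (a j) S)"
    if W: "W \<subseteq> V" "card W = r * p" for W
  proof -
    have "r * (p - 1) < card W" using W factor.prems(2) prime_gt_0_nat[OF p] by simp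
    moreover have "finite W" using W factor.prems(3) finite_subset by blast
    ultimately show ?thesis using zero_sum_subset_prime[OF p, of W r a] by metis
  qed
  ultimately obtain S where
    S: "\<And>i. i < ?K \<Longrightarrow> S i \<subseteq> V \<and> S i \<noteq> {} \<and> (\<forall>j<r. int p dvd sum (a j) (S i))"
    and disj: "disjoint_family_on S {..<?K}"
    using disjoint_family_of_good_subsets[of V "r * p" "\<lambda>S. \<forall>j<r. int p dvd sum (a j) S" ?K] factor.prems(3)
    by metis
  obtain I where I: "I \<subseteq> {..<?K}" "I \<noteq> {}"
    "\<And>j. j < r \<Longrightarrow> int m dvd (\<Sum>i\<in>I. sum (a j) (S i) div int p)"
    using factor.IH[of "{..<?K}" "\<lambda>j i. sum (a j) (S i) div int p"] m factor.prems(2) by auto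
  have "finite I" using I(1) finite_subset by blast
  moreover have "finite (S i)" if "i \<in> I" for i
    using S[of i] that I(1) factor.prems(3) by (auto intro: finite_subset)
  ultimately have fin: "finite I" "\<And>i. i \<in> I \<Longrightarrow> finite (S i)" by auto
  have "int (p * m) dvd sum (a j) (\<Union>i\<in>I. S i)" if j: "j < r" for j
  proof -
    have "sum (a j) (\<Union>i\<in>I. S i) = (\<Sum>i\<in>I. sum (a j) (S i))"
      using disj I(1) fin by (intro sum.UNION_disjoint) (auto simp: disjoint_family_on_def subset_iff)
    also have "\<dots> = (\<Sum>i\<in>I. int p * (sum (a j) (S i) div int p))"
      using S I(1) j by (intro sum.cong) auto
    also have "\<dots> = int p * (\<Sum>i\<in>I. sum (a j) (S i) div int p)"
      by (simp only: sum_distrib_left)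
    finally show ?thesis using I(3)[OF j] by simp
  qed
  moreover have "(\<Union>i\<in>I. S i) \<subseteq> V"
    by (rule UN_least) (use S I(1) in auto)
  moreover have "(\<Union>i\<in>I. S i) \<noteq> {}"
    using S I(1,2) by (fastforce simp: subset_iff)
  ultimately show ?case by (intro exI[of _ "\<Union>i\<in>I. S i"]) simp
qed

section \<open>Mutually orthogonal blocks and quadratic set functions\<close>

text \<open>With \<open>b i j\<close> as the coefficient of \<open>x_i x_j\<close>, this is the
  mixed part of a quadratic form at the union of two disjoint blocks. As \<open>b\<close> may be
  asymmetric, the order of the blocks matters.\<close>

definition cross :: "(nat \<Rightarrow> nat \<Rightarrow> int) \<Rightarrow> nat set \<Rightarrow> nat set \<Rightarrow> int" where
  "cross b S T = (\<Sum>i\<in>S. \<Sum>j\<in>T. b i j)"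

text \<open>Once the earlier blocks are fixed, orthogonality to each of them is one linear condition
  modulo \<open>m\<close> on the indicator vector of the new block. The zero-sum lemma then finds
  this block among the elements not yet reserved.\<close>

lemma orthogonal_family:
  fixes b :: "nat \<Rightarrow> nat \<Rightarrow> int"
  assumes "m > 0" "k \<le> m" "finite V" "k * (m ^ size (prime_factorization m) * m) \<le> card V"
  shows "\<exists>S :: nat \<Rightarrow> nat set. (\<forall>i<k. S i \<subseteq> V \<and> S i \<noteq> {}) \<and> disjoint_family_on S {..<k} \<and>
    (\<forall>j<k. \<forall>i<j. int m dvd cross b (S i) (S j))"
  using assms(2-)
proof (induction k arbitrary: V)
  case 0
  show ?case by (simp add: disjoint_family_on_def)
next
  case (Suc k)
  let ?Q = "m ^ size (prime_factorization m) * m"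
  have "k * ?Q \<le> card V" using Suc.prems(3) by simp
  \<comment> \<open>The earlier blocks are confined to exactly \<open>k * ?Q\<close> elements, so
    that \<open>?Q\<close> elements remain for the new one.\<close>
  then obtain W where W: "W \<subseteq> V" "card W = k * ?Q" by (meson obtain_subset_with_card_n)
  have finW: "finite W" using W(1) Suc.prems(2) finite_subset by blast
  obtain S where S: "\<And>i. i < k \<Longrightarrow> S i \<subseteq> W \<and> S i \<noteq> {}" "disjoint_family_on S {..<k}"
    "\<And>i j. j < k \<Longrightarrow> i < j \<Longrightarrow> int m dvd cross b (S i) (S j)"
    using Suc.IH[OF _ finW] W(2) Suc.prems(1) by (metis Suc_leD order_refl)
  have "?Q \<le> card (V - W)"
    using W finW Suc.prems(3) by (simp add: card_Diff_subset)
  \<comment> \<open>Conditions are imposed for all \<open>i < m\<close>, although only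
    \<open>k\<close> blocks exist so far and \<open>S i\<close> is arbitrary for larger
    \<open>i\<close>. This keeps the number of elements required independent of
    \<open>k\<close>.\<close>
  then obtain T where T: "T \<subseteq> V - W" "T \<noteq> {}"
    "\<And>i. i < m \<Longrightarrow> int m dvd (\<Sum>j\<in>T. \<Sum>l\<in>S i. b l j)"
    using zero_sum_subset[of m m "V - W" "\<lambda>i j. \<Sum>l\<in>S i. b l j"] assms(1) Suc.prems(2) by auto
  have T': "int m dvd cross b (S i) T" if "i < k" for i
    using T(3)[of i] that Suc.prems(1) unfolding cross_def by (subst sum.swap) simp
  have "disjoint_family_on (S(k := T)) {..<Suc k}"
    using S(1,2) T(1) unfolding disjoint_family_on_def by (fastforce simp: less_Suc_eq)
  moreover have "\<forall>i<Suc k. (S(k := T)) i \<subseteq> V \<and> (S(k := T)) i \<noteq> {}"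
  proof (intro allI impI)
    fix i assume "i < Suc k"
    then show "(S(k := T)) i \<subseteq> V \<and> (S(k := T)) i \<noteq> {}"
      using S(1)[of i] T(1,2) W(1) by (cases "i = k") auto
  qed
  moreover have "\<forall>j<Suc k. \<forall>i<j. int m dvd cross b ((S(k := T)) i) ((S(k := T)) j)"
  proof (intro allI impI)
    fix i j assume "j < Suc k" "i < j"
    then show "int m dvd cross b ((S(k := T)) i) ((S(k := T)) j)"
      using S(3)[of j i] T'[of i] by (cases "j = k") auto
  qed
  ultimately show ?case by (intro exI[of _ "S(k := T)"] conjI)
qed

lemma cross_UN_right:
  assumes "finite I" "\<And>i. i \<in> I \<Longrightarrow> finite (S i)" "disjoint_family_on S I"
  shows "cross b T (\<Union>i\<in>I. S i) = (\<Sum>i\<in>I. cross b T (S i))"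
proof -
  have "(\<Sum>j\<in>(\<Union>i\<in>I. S i). b t j) = (\<Sum>i\<in>I. \<Sum>j\<in>S i. b t j)" for t
    using assms by (intro sum.UNION_disjoint) (auto simp: disjoint_family_on_def)
  then show ?thesis unfolding cross_def by (simp add: sum.swap[of _ I T])
qed

text \<open>\<open>F\<close> stands for a quadratic polynomial without constant term, read on
  indicator vectors. On unions of orthogonal blocks it is additive modulo \<open>m\<close>, and
  among the values at \<open>m\<close> blocks some nonempty subfamily sums to zero.\<close>

lemma quadratic_vanishes:
  fixes F :: "nat set \<Rightarrow> int"
  assumes "m > 0" "finite V" "m ^ (size (prime_factorization m) + 2) \<le> card V"
    and F0: "F {} = 0"
    and F_Un: "\<And>S T. S \<subseteq> V \<Longrightarrow> T \<subseteq> V \<Longrightarrow> S \<inter> T = {} \<Longrightarrow> F (S \<union> T) = F S + F T + cross b S T"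
  shows "\<exists>S\<subseteq>V. S \<noteq> {} \<and> int m dvd F S"
proof -
  have "m * (m ^ size (prime_factorization m) * m) \<le> card V"
    using assms(3) by (simp add: mult_ac)
  then obtain S where S: "\<And>i. i < m \<Longrightarrow> S i \<subseteq> V \<and> S i \<noteq> {}" "disjoint_family_on S {..<m}"
    "\<And>i j. j < m \<Longrightarrow> i < j \<Longrightarrow> int m dvd cross b (S i) (S j)"
    using orthogonal_family[OF assms(1) order_refl assms(2), of b] by metis
  \<comment> \<open>With a single condition the zero-sum bound is just \<open>m\<close>, the number
    of blocks.\<close>
  obtain I where I: "I \<subseteq> {..<m}" "I \<noteq> {}" "int m dvd (\<Sum>i\<in>I. F (S i))"
    using zero_sum_subset[of m 1 "{..<m}" "\<lambda>_ i. F (S i)"] assms(1) by auto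
  have fin: "finite (S i)" if "i < m" for i
    using S(1)[OF that] assms(2) finite_subset by blast
  have "[F (\<Union>i\<in>J. S i) = (\<Sum>i\<in>J. F (S i))] (mod int m)" if "finite J" "J \<subseteq> {..<m}" for J
    using that
  \<comment> \<open>Each new index is smaller than all earlier ones, since
    \<open>cross b (S i) (S j)\<close> is known to be divisible by \<open>m\<close> only for
    \<open>i < j\<close>.\<close>
  proof (induction J rule: finite_linorder_min_induct)
    case empty
    show ?case by (simp add: F0)
  next
    case (insert t J)
    have t: "t < m" "t \<notin> J" and J: "J \<subseteq> {..<m}" using insert by auto
    have "S t \<inter> (\<Union>i\<in>J. S i) = {}"
    proof -
      have "S t \<inter> S i = {}" if "i \<in> J" for i
        using disjoint_family_onD[OF S(2), of t i] that t J by auto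
      then show ?thesis by blast
    qed
    moreover have "(\<Union>i\<in>J. S i) \<subseteq> V"
      by (rule UN_least) (use S(1) J in auto)
    ultimately have "F (\<Union>i\<in>insert t J. S i) =
        F (S t) + F (\<Union>i\<in>J. S i) + cross b (S t) (\<Union>i\<in>J. S i)"
      using F_Un S(1) t(1) by simp
    moreover have "cross b (S t) (\<Union>i\<in>J. S i) = (\<Sum>i\<in>J. cross b (S t) (S i))"
      using insert.hyps(1) J fin S(2) by (intro cross_UN_right) (auto simp: disjoint_family_on_def subset_iff)
    moreover have "int m dvd (\<Sum>i\<in>J. cross b (S t) (S i))"
      using S(3) insert.hyps(2) J by (intro dvd_sum) auto
    ultimately have "[F (\<Union>i\<in>insert t J. S i) = F (S t) + F (\<Union>i\<in>J. S i)] (mod int m)"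
      by (simp add: cong_iff_dvd_diff)
    also have "[F (S t) + F (\<Union>i\<in>J. S i) = F (S t) + (\<Sum>i\<in>J. F (S i))] (mod int m)"
      using insert.IH J by (intro cong_add) auto
    finally show ?case using insert.hyps(1) t(2) by simp
  qed
  then have "[F (\<Union>i\<in>I. S i) = (\<Sum>i\<in>I. F (S i))] (mod int m)"
    using I(1) finite_subset by blast
  then have "int m dvd F (\<Union>i\<in>I. S i)"
    using I(3) cong_dvd_iff by blast
  moreover have "(\<Union>i\<in>I. S i) \<subseteq> V"
    by (rule UN_least) (use S(1) I(1) in auto)
  moreover have "(\<Union>i\<in>I. S i) \<noteq> {}"
    using S(1) I(1,2) by (fastforce simp: subset_iff)
  ultimately show ?thesis by (intro exI[of _ "\<Union>i\<in>I. S i"]) simp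
qed

section \<open>Polynomials over the integers modulo \<open>m\<close> at 0/1 points\<close>

lemma (in ring) mpoly_support_index:
  assumes "P \<in> indexed_pset I (carrier R)" "M \<in> mpoly_support R P"
  shows "set_mset M \<subseteq> I"
  using assms
proof (induction arbitrary: M)
  case (indexed_const k)
  then show ?case by (auto simp: mpoly_support_def indexed_const_def split: if_splits)
next
  case (indexed_padd P Q)
  then have "M \<in> mpoly_support R P \<or> M \<in> mpoly_support R Q"
    by (auto simp: mpoly_support_def indexed_padd_def)
  then show ?case using indexed_padd.IH by blast
next
  case (indexed_pmult P i)
  then have "i \<in># M" "M - {#i#} \<in> mpoly_support R P"
    by (auto simp: mpoly_support_def indexed_pmult_def split: if_splits)
  then show ?case using indexed_pmult.IH[of "M - {#i#}"] indexed_pmult.hyps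
    by (metis insert_DiffM insert_subset set_mset_add_mset_insert)
qed

text \<open>At a 0/1 point a monomial is 1 or 0 according to whether all its variables lie in
  \<open>S\<close>, whatever the exponents. Evaluation thus becomes an integer sum reduced once,
  free of ring operations.\<close>

lemma (in residues) mpoly_eval_indicator:
  assumes f: "f \<in> indexed_pset I (carrier R)" and S: "S \<subseteq> I"
    and x: "\<And>i. i \<in> I \<Longrightarrow> x i = (if i \<in> S then 1 else 0)"
  shows "mpoly_eval R f x = (\<Sum>M | M \<in> mpoly_support R f \<and> set_mset M \<subseteq> S. f M) mod m"
proof -
  have fin: "finite (mpoly_support R f)" using f by (rule finite_mpoly_support)
  have one: "1 mod m = 1" using m_gt_one by simp
  have mono: "(\<Otimes>i \<in> set_mset M. x i [^] count M i) = (if set_mset M \<subseteq> S then 1 else 0)"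
    if M: "M \<in> mpoly_support R f" for M
  proof -
    have xM: "x i = (if i \<in> S then 1 else 0)" if "i \<in># M" for i
      using that x mpoly_support_index[OF f M] by blast
    have "(\<Otimes>i \<in> set_mset M. x i [^] count M i) = (\<Otimes>i \<in> set_mset M. (x i ^ count M i) mod m)"
    proof (rule finprod_cong')
      show "x i [^] count M i = (x i ^ count M i) mod m" if "i \<in># M" for i
        using pow_cong[of "x i" "count M i"] xM[OF that] one by (auto split: if_splits)
    qed auto
    also have "\<dots> = (\<Prod>i \<in> set_mset M. x i ^ count M i) mod m"
      by (rule prod_cong) simp
    also have "(\<Prod>i \<in> set_mset M. x i ^ count M i) = (if set_mset M \<subseteq> S then 1 else 0)"
    proof (cases "set_mset M \<subseteq> S")
      case True
      then show ?thesis using xM by (auto intro!: prod.neutral)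
    next
      case False
      then obtain i where "i \<in># M" "i \<notin> S" by blast
      then show ?thesis using False xM[of i] by (auto intro!: bexI[of _ i] simp: power_0_left)
    qed
    finally show ?thesis using one by simp
  qed
  have "mpoly_eval R f x = (\<Oplus>M \<in> mpoly_support R f. (if set_mset M \<subseteq> S then f M else 0) mod m)"
    unfolding mpoly_eval_def
  proof (rule finsum_cong')
    show "f M \<otimes> (\<Otimes>i \<in> set_mset M. x i [^] count M i) = (if set_mset M \<subseteq> S then f M else 0) mod m"
      if "M \<in> mpoly_support R f" for M
      using mono[OF that] by (simp add: res_mult_eq)
  qed auto
  also have "\<dots> = (\<Sum>M \<in> mpoly_support R f. if set_mset M \<subseteq> S then f M else 0) mod m"
    using fin by (rule sum_cong)
  finally show ?thesis using fin by (simp add: sum.inter_filter)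
qed

lemma size_le_2_cases:
  assumes "size M \<le> 2"
  obtains "M = {#}" | i where "M = {#i#}" | i j where "M = {#i, j#}"
proof (cases M)
  case (add i N)
  then have "size N \<le> 1" using assms by simp
  then have "N = {#} \<or> (\<exists>j. N = {#j#})"
    by (metis One_nat_def le_Suc_eq le_zero_eq size_1_singleton_mset size_eq_0_iff_empty)
  then show ?thesis using add that by blast
qed (use that in simp)

text \<open>A monomial of size at most 2 on the union that lives on neither set alone is a mixed
  pair \<open>{#i, j#}\<close>. The constant monomial is excluded because it would be counted twice
  on the right.\<close>

lemma sum_monomials_Un:
  fixes f :: "nat multiset \<Rightarrow> int"
  assumes fin: "finite Y" and deg: "\<And>M. M \<in> Y \<Longrightarrow> size M \<le> 2 \<and> M \<noteq> {#}"
    and zero: "\<And>M. size M = 2 \<Longrightarrow> M \<notin> Y \<Longrightarrow> f M = 0"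
    and ST: "finite S" "finite T" "S \<inter> T = {}"
  shows "(\<Sum>M | M \<in> Y \<and> set_mset M \<subseteq> S \<union> T. f M) =
    (\<Sum>M | M \<in> Y \<and> set_mset M \<subseteq> S. f M) + (\<Sum>M | M \<in> Y \<and> set_mset M \<subseteq> T. f M) +
    cross (\<lambda>i j. f {#i, j#}) S T"
proof -
  let ?A = "\<lambda>S. {M. M \<in> Y \<and> set_mset M \<subseteq> S}"
  let ?p = "\<lambda>(i, j). {#i, j#}"
  \<comment> \<open>As \<open>S\<close> and \<open>T\<close> are disjoint, the unordered pair
    determines which entry comes from which set.\<close>
  have inj: "inj_on ?p (S \<times> T)"
    using ST(3) by (auto simp: inj_on_def add_eq_conv_ex)
  have "?A (S \<union> T) = (?A S \<union> ?A T) \<union> (?p ` (S \<times> T) \<inter> Y)"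
  proof (intro equalityI subsetI)
    fix M assume M: "M \<in> ?A (S \<union> T)"
    then have "size M \<le> 2" "M \<noteq> {#}" using deg by auto
    then show "M \<in> (?A S \<union> ?A T) \<union> (?p ` (S \<times> T) \<inter> Y)"
    proof (cases rule: size_le_2_cases)
      case (3 i j)
      have "M \<in> ?p ` (S \<times> T)" if "\<not> set_mset M \<subseteq> S" "\<not> set_mset M \<subseteq> T"
      proof -
        from that M 3 have "(i, j) \<in> S \<times> T \<or> (j, i) \<in> S \<times> T" by auto
        moreover have "M = ?p (i, j)" "M = ?p (j, i)" using 3 by (simp_all add: add_mset_commute)
        ultimately show ?thesis by (metis image_eqI)
      qed
      then show ?thesis using M by auto
    qed (use M in auto)
  qed auto
  moreover have "?A S \<inter> ?A T = {}"
  proof -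
    have "set_mset M = {}" if "set_mset M \<subseteq> S" "set_mset M \<subseteq> T" for M
      using that ST(3) by blast
    then show ?thesis using deg by auto
  qed
  moreover have "(?A S \<union> ?A T) \<inter> (?p ` (S \<times> T) \<inter> Y) = {}"
    using ST(3) by auto
  ultimately have "sum f (?A (S \<union> T)) = sum f (?A S) + sum f (?A T) + sum f (?p ` (S \<times> T) \<inter> Y)"
    using fin by (simp add: sum.union_disjoint)
  also have "sum f (?p ` (S \<times> T) \<inter> Y) = sum f (?p ` (S \<times> T))"
    using ST by (intro sum.mono_neutral_left) (auto intro!: zero)
  also have "\<dots> = cross (\<lambda>i j. f {#i, j#}) S T"
    unfolding cross_def sum.reindex[OF inj] sum.cartesian_product
    by (simp add: case_prod_unfold o_def)
  finally show ?thesis .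
qed

section \<open>The bound for polynomials representing OR\<close>

text \<open>For larger \<open>n\<close> some nonempty \<open>S\<close> has an indicator vector at
  which \<open>f\<close> takes its value at the origin. OR distinguishes these two points, which no
  weak representation by \<open>f\<close> permits.\<close>

lemma weakly_represents_OR_bound:
  assumes m: "m > 1" and f: "f \<in> mpoly_over_Zm m n"
    and deg: "mpoly_degree (residue_ring (int m)) f \<le> 2"
    and rep: "weakly_represents m n (mpoly_eval (residue_ring (int m)) f) (OR n)"
  shows "n < m ^ (size (prime_factorization m) + 2)"
proof (rule ccontr)
  assume large: "\<not> ?thesis"
  define R where "R = residue_ring (int m)"
  interpret residues "int m" R
    by unfold_locales (use m R_def in auto)
  have f': "f \<in> indexed_pset {1..n} (carrier R)"
    using f by (simp add: mpoly_over_Zm_def R_def)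
  have fin: "finite (mpoly_support R f)" using f' by (rule finite_mpoly_support)
  have size: "size M \<le> 2" if "M \<in> mpoly_support R f" for M
    using deg that fin unfolding mpoly_degree_def R_def[symmetric] by simp
  \<comment> \<open>Dropping the constant monomial gives \<open>F {} = 0\<close>; its coefficient
    \<open>c\<close> is handled separately.\<close>
  let ?X = "mpoly_support R f - {{#}}"
  define F where "F S = (\<Sum>M | M \<in> ?X \<and> set_mset M \<subseteq> S. f M)" for S
  \<comment> \<open>The restriction makes \<open>x S\<close> extensional, as membership in
    \<open>cube n\<close> requires.\<close>
  define x where "x S = (\<lambda>i\<in>{1..n}. if i \<in> S then 1 else 0 :: int)" for S
  define c where "c = f {#}"
  have eval: "mpoly_eval R f (x S) = (c + F S) mod int m" if S: "S \<subseteq> {1..n}" for S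
  proof -
    have "mpoly_eval R f (x S) = (\<Sum>M | M \<in> mpoly_support R f \<and> set_mset M \<subseteq> S. f M) mod int m"
      using S by (intro mpoly_eval_indicator[OF f']) (auto simp: x_def)
    \<comment> \<open>If \<open>{#}\<close> lies outside the support, its coefficient is 0 and
      inserting it is harmless.\<close>
    also have "(\<Sum>M | M \<in> mpoly_support R f \<and> set_mset M \<subseteq> S. f M) =
        (\<Sum>M \<in> insert {#} {M. M \<in> ?X \<and> set_mset M \<subseteq> S}. f M)"
      using fin by (intro sum.mono_neutral_left) (auto simp: mpoly_support_def res_zero_eq)
    also have "\<dots> = c + F S" using fin by (simp add: F_def c_def)
    finally show ?thesis .
  qed
  have "\<exists>S\<subseteq>{1..n}. S \<noteq> {} \<and> int m dvd F S"
  proof (rule quadratic_vanishes)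
    show "F {} = 0" unfolding F_def by (intro sum.neutral) auto
    show "F (S \<union> T) = F S + F T + cross (\<lambda>i j. f {#i, j#}) S T"
      if "S \<subseteq> {1..n}" "T \<subseteq> {1..n}" "S \<inter> T = {}" for S T
      unfolding F_def using that fin size
      by (intro sum_monomials_Un) (auto simp: mpoly_support_def res_zero_eq intro: finite_subset)
  qed (use m large in auto)
  then obtain S where S: "S \<subseteq> {1..n}" "S \<noteq> {}" "int m dvd F S" by blast
  have "mpoly_eval R f (x S) = mpoly_eval R f (x {})"
  proof -
    have "[c + F S = c + F {}] (mod int m)"
      using S(3) by (intro cong_add) (auto simp: F_def cong_0_iff)
    then show ?thesis using S(1) by (simp add: eval cong_def)
  qed
  moreover have "x T \<in> cube n" for T by (auto simp: x_def cube_def)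
  moreover have "OR n (x {}) = 0" by (simp add: OR_def x_def)
  moreover have "OR n (x S) = 1" using S(1,2) by (auto simp: OR_def x_def)
  ultimately show False
    using rep unfolding weakly_represents_def R_def[symmetric] by (metis DiffD2)
qed

text \<open>\<open>m\<close> is the product of its prime factors, each of which is at least
  2.\<close>

lemma size_prime_factorization_le_log:
  assumes "m > 0"
  shows "real (size (prime_factorization m)) \<le> log 2 (real m)"
proof -
  have "2 ^ size A \<le> prod_mset A" if "\<And>p. p \<in># A \<Longrightarrow> 2 \<le> p" for A :: "nat multiset"
    using that
  proof (induction A)
    case (add p A)
    then have "2 * 2 ^ size A \<le> p * prod_mset A" by (intro mult_le_mono) auto
    then show ?case by simp
  qed simp
  then have "2 ^ size (prime_factorization m) \<le> prod_mset (prime_factorization m)"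
    by (metis in_prime_factors_imp_prime prime_ge_2_nat)
  then have "2 ^ size (prime_factorization m) \<le> m"
    using assms by simp
  then show ?thesis by (rule le_log2_of_power)
qed

theorem theorem1p2:
  shows "\<exists>C::real. \<forall>(m::nat) (d::nat) (n::nat) f.
    m > 1 \<longrightarrow> d = size (prime_factorization m) \<longrightarrow>
    f \<in> mpoly_over_Zm m n \<longrightarrow> mpoly_degree (residue_ring (int m)) f \<le> 2 \<longrightarrow>
    weakly_represents m n (mpoly_eval (residue_ring (int m)) f) (OR n) \<longrightarrow>
    real n \<le> real m powr (C * real d) \<and>
    real m powr (C * real d) \<le> real m powr (C * log 2 (real m))"
proof (intro exI[of _ 3] allI impI conjI)
  fix m d n :: nat and f
  assume m: "m > 1" and d: "d = size (prime_factorization m)"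
    and f: "f \<in> mpoly_over_Zm m n" "mpoly_degree (residue_ring (int m)) f \<le> 2"
      "weakly_represents m n (mpoly_eval (residue_ring (int m)) f) (OR n)"
  have "prime_factorization m \<noteq> {#}"
    using m by (simp add: prime_factorization_empty_iff)
  then have "d \<ge> 1" using d by (simp add: Suc_leI nonempty_has_size)
  have "n \<le> m ^ (d + 2)"
    using weakly_represents_OR_bound[OF m f] d by simp
  \<comment> \<open>The constant 3 absorbs the additive 2 in the exponent:
    \<open>d + 2 \<le> 3 * d\<close> because \<open>d \<ge> 1\<close>.\<close>
  also have "\<dots> \<le> m ^ (3 * d)"
    using m \<open>d \<ge> 1\<close> by (intro power_increasing) auto
  finally have "real n \<le> real m ^ (3 * d)"
    by (metis of_nat_le_iff of_nat_power)
  also have "\<dots> = real m powr (3 * real d)"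
    using m by (simp flip: powr_realpow)
  finally show "real n \<le> real m powr (3 * real d)" .
  show "real m powr (3 * real d) \<le> real m powr (3 * log 2 (real m))"
    using m d size_prime_factorization_le_log[of m] by (intro powr_mono) auto
qed

end
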